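(* Assume $N>2$, $d\in\mathbb{N}$, $\rho\in(0,2]$ with $\rho>\rho_c=d\frac{N-1}{N+1}$, and $\kappa>0$ sufficiently small. Let $\tau\in\mathcal{F}_F$ be an element of type $(p,q,0)$ having negative homogeneity. Then - if $q$ is a multiple of $N$, the bare tree representing $\tau$ is a regular tree of degree $N$ with $q+1$ vertices; - otherwise, the bare tree representing $\tau$ is obtained by removing $r$ edges, where $1\le r\le N-1$, from a regular tree of degree $N$ with $q+r+1$ vertices.
   Context: Scaling $\mathfrak{s}=(\rho,1,\dots,1)$, $|k|_{\mathfrak{s}}=\rho k_0+k_1+\dots+k_d$ for $k\in\mathbb{N}_0^{d+1}$, and (space-time white noise) $\alpha_0=-\frac{\rho+d}{2}-\kappa$. Formal symbols are built from $\mathbf{1}$, $X_0,\dots,X_d$, $\Xi$ by a commutative associative product with unit $\mathbf{1}$ and a unary operation $\mathcal{I}_\rho$; $X^k=X_0^{k_0}\cdots X_d^{k_d}$. By convention $\mathcal{I}_\rho(X^k)=0$ for all $k$ (in particular $\mathcal{I}_\rho(\mathbf{1})=0$), and $0$ is not listed as a symbol. Set $\mathcal{W}_0=\mathcal{U}_0=\emptyset$ and, for $m\ge1$, $$\mathcal{W}_m=\mathcal{W}_{m-1}\cup\{\Xi\}\cup\bigcup_{n=1}^N\{\tau_1\cdots\tau_n:\tau_i\in\mathcal{U}_{m-1}\},\qquad \mathcal{U}_m=\{X^k:k\in\mathbb{N}_0^{d+1}\}\cup\{\mathcal{I}_\rho(\tau):\tau\in\mathcal{W}_m\},$$ and $\mathcal{F}_F=\bigcup_{m\ge0}(\mathcal{W}_m\cup\mathcal{U}_m)$.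 A symbol is of type $(p,q,k)$ if it contains $p$ occurrences of $\Xi$, $q$ of $\mathcal{I}_\rho$, and monomials of total exponent $k$; its homogeneity is $|\tau|_{\mathfrak{s}}=p\alpha_0+q\rho+|k|_{\mathfrak{s}}$. The bare tree of a symbol $\tau$ is the (unordered) rooted tree defined recursively: the bare trees of $\Xi$ and of $X^k$ are a single vertex (the root); the bare tree of $\mathcal{I}_\rho(\tau)$ is obtained by attaching the root of the bare tree of $\tau$ to a new root by an edge; the bare tree of a product is obtained by joining the bare trees at their roots. Thus it has $q$ edges and $q+1$ vertices. A regular tree of degree $N$ is a rooted tree in which each vertex except the leaves has exactly $N$ children (a single vertex is allowed). "Removing an edge" means removing an edge adjacent to a leaf together with that leaf. *)

theory Defs
  imports Complex_Main "HOL-Library.Multiset"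
begin

section \<open>Symbols\<close>

text \<open>
  A symbol is a multiset of irreducible factors. This is the free structure generated by
  the \<open>X\<^sub>i\<close> and \<open>\<Xi>\<close> under a commutative associative product with unit
  and a unary operation \<open>\<I>\<^sub>\<rho>\<close> on symbols: the product is multiset union \<open>+\<close> and the
  unit symbol is the empty multiset.
\<close>

datatype factor = X nat | Xi | Integ "factor multiset"

type_synonym symbol = "factor multiset"

definition noise :: symbol where
  "noise = {#Xi#}"

definition integ :: "symbol \<Rightarrow> symbol" where
  "integ \<tau> = {#Integ \<tau>#}"

text \<open>\<open>X\<^sup>k\<close> for \<open>k \<in> \<nat>\<^sub>0\<^sup>d\<^sup>+\<^sup>1\<close>; only the values \<open>k 0, \<dots>, k d\<close> are used.\<close>

definition monomial :: "nat \<Rightarrow> (nat \<Rightarrow> nat) \<Rightarrow> symbol" where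
  "monomial d k = (\<Sum>i\<le>d. replicate_mset (k i) (X i))"

text \<open>
  The side condition \<open>\<tau> \<notin> range (monomial d)\<close> implements the convention \<open>\<I>\<^sub>\<rho>(X\<^sup>k) = 0\<close>,
  with \<open>0\<close> not being listed as a symbol.
\<close>

fun W :: "nat \<Rightarrow> nat \<Rightarrow> nat \<Rightarrow> symbol set" and U :: "nat \<Rightarrow> nat \<Rightarrow> nat \<Rightarrow> symbol set" where
  "W N d 0 = {}"
| "U N d 0 = {}"
| "W N d (Suc m) = W N d m \<union> {noise} \<union>
     (\<Union>n\<in>{1..N}. {\<Sum>i=1..n. \<tau> i | \<tau>. \<forall>i\<in>{1..n}. \<tau> i \<in> U N d m})"
| "U N d (Suc m) = range (monomial d) \<union>
     {integ \<tau> | \<tau>. \<tau> \<in> W N d (Suc m) \<and> \<tau> \<notin> range (monomial d)}"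

definition symbols_F :: "nat \<Rightarrow> nat \<Rightarrow> symbol set" where
  "symbols_F N d = (\<Union>m. W N d m \<union> U N d m)"

section \<open>Type and homogeneity\<close>

primrec noises_factor :: "factor \<Rightarrow> nat" where
  "noises_factor (X i) = 0"
| "noises_factor Xi = 1"
| "noises_factor (Integ \<tau>) = \<Sum>\<^sub># (image_mset noises_factor \<tau>)"

primrec integs_factor :: "factor \<Rightarrow> nat" where
  "integs_factor (X i) = 0"
| "integs_factor Xi = 0"
| "integs_factor (Integ \<tau>) = 1 + \<Sum>\<^sub># (image_mset integs_factor \<tau>)"

primrec exponent_factor :: "nat \<Rightarrow> factor \<Rightarrow> nat" where
  "exponent_factor j (X i) = (if i = j then 1 else 0)"
| "exponent_factor j Xi = 0"
| "exponent_factor j (Integ \<tau>) = \<Sum>\<^sub># (image_mset (exponent_factor j) \<tau>)"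

definition noises :: "symbol \<Rightarrow> nat" where
  "noises \<tau> = \<Sum>\<^sub># (image_mset noises_factor \<tau>)"

definition integs :: "symbol \<Rightarrow> nat" where
  "integs \<tau> = \<Sum>\<^sub># (image_mset integs_factor \<tau>)"

definition exponent :: "symbol \<Rightarrow> nat \<Rightarrow> nat" where
  "exponent \<tau> j = \<Sum>\<^sub># (image_mset (exponent_factor j) \<tau>)"

definition of_type :: "symbol \<Rightarrow> nat \<Rightarrow> nat \<Rightarrow> (nat \<Rightarrow> nat) \<Rightarrow> bool" where
  "of_type \<tau> p q k \<longleftrightarrow> noises \<tau> = p \<and> integs \<tau> = q \<and> exponent \<tau> = k"

definition scaled_degree :: "nat \<Rightarrow> real \<Rightarrow> (nat \<Rightarrow> nat) \<Rightarrow> real" where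
  "scaled_degree d \<rho> k = \<rho> * real (k 0) + (\<Sum>i=1..d. real (k i))"

definition alpha0 :: "nat \<Rightarrow> real \<Rightarrow> real \<Rightarrow> real" where
  "alpha0 d \<rho> \<kappa> = - (\<rho> + real d) / 2 - \<kappa>"

definition homogeneity :: "nat \<Rightarrow> real \<Rightarrow> real \<Rightarrow> symbol \<Rightarrow> real" where
  "homogeneity d \<rho> \<kappa> \<tau> =
     real (noises \<tau>) * alpha0 d \<rho> \<kappa> + real (integs \<tau>) * \<rho> + scaled_degree d \<rho> (exponent \<tau>)"

definition rho_c :: "nat \<Rightarrow> nat \<Rightarrow> real" where
  "rho_c N d = real d * (real N - 1) / (real N + 1)"

section \<open>Rooted trees\<close>

text \<open>Unordered rooted trees, given by the multiset of subtrees hanging off the root.\<close>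

datatype rtree = Node (children: "rtree multiset")

primrec vertices :: "rtree \<Rightarrow> nat" where
  "vertices (Node ts) = 1 + \<Sum>\<^sub># (image_mset vertices ts)"

inductive regular_tree :: "nat \<Rightarrow> rtree \<Rightarrow> bool" for N :: nat where
  leaf: "regular_tree N (Node {#})"
| inner: "size ts = N \<Longrightarrow> (\<forall>t\<in>#ts. regular_tree N t) \<Longrightarrow> regular_tree N (Node ts)"

text \<open>
  \<open>remove_edge t t'\<close>: the tree \<open>t'\<close> arises from \<open>t\<close> by deleting one leaf together with the
  edge joining it to its parent.
\<close>

inductive remove_edge :: "rtree \<Rightarrow> rtree \<Rightarrow> bool" where
  here: "remove_edge (Node (add_mset (Node {#}) ts)) (Node ts)"
| below: "remove_edge t t' \<Longrightarrow> remove_edge (Node (add_mset t ts)) (Node (add_mset t' ts))"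

definition join_roots :: "rtree multiset \<Rightarrow> rtree" where
  "join_roots ts = Node (\<Sum>\<^sub># (image_mset children ts))"

primrec bare_tree_factor :: "factor \<Rightarrow> rtree" where
  "bare_tree_factor (X i) = Node {#}"
| "bare_tree_factor Xi = Node {#}"
| "bare_tree_factor (Integ \<tau>) = Node {#join_roots (image_mset bare_tree_factor \<tau>)#}"

definition bare_tree :: "symbol \<Rightarrow> rtree" where
  "bare_tree \<tau> = join_roots (image_mset bare_tree_factor \<tau>)"

lemma bare_tree_noise: "bare_tree noise = Node {#}"
  by (simp add: bare_tree_def join_roots_def noise_def)

lemma bare_tree_integ: "bare_tree (integ \<tau>) = Node {#bare_tree \<tau>#}"
  by (simp add: bare_tree_def join_roots_def integ_def)

lemma bare_tree_product:
  "bare_tree (\<sigma> + \<tau>) = Node (children (bare_tree \<sigma>) + children (bare_tree \<tau>))"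
  by (simp add: bare_tree_def join_roots_def)

lemma bare_tree_monomial: "bare_tree (monomial d k) = Node {#}"
proof -
  have rep: "children (bare_tree (replicate_mset n (X i))) = {#}" for n i
    by (simp add: bare_tree_def join_roots_def)
  have "children (bare_tree (\<Sum>i\<in>A. replicate_mset (k i) (X i))) = {#}" if "finite A" for A
    using that
    by induction (simp_all add: bare_tree_product rep, simp add: bare_tree_def join_roots_def)
  then have "children (bare_tree (monomial d k)) = {#}"
    by (simp add: monomial_def)
  then show ?thesis
    by (metis rtree.collapse)
qed

lemma vertices_bare_tree: "vertices (bare_tree \<tau>) = integs \<tau> + 1"
proof -
  have sum: "vertices (join_roots (image_mset bare_tree_factor \<tau>)) = integs \<tau> + 1"
    if "\<And>f. f \<in># \<tau> \<Longrightarrow> vertices (bare_tree_factor f) = integs_factor f + 1" for \<tau>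
    using that
  proof (induction \<tau>)
    case (add f \<tau>)
    have "vertices (bare_tree_factor f) = integs_factor f + 1"
      by (simp add: add.prems)
    then show ?case
      using add by (cases "bare_tree_factor f") (simp add: join_roots_def integs_def)
  qed (simp add: join_roots_def integs_def)
  have "vertices (bare_tree_factor f) = integs_factor f + 1" for f
    by (induction f) (simp_all add: sum, simp add: integs_def)
  then show ?thesis
    by (simp add: bare_tree_def sum)
qed

end

theory Submission
  imports Defs
begin

text \<open>
  An element of \<open>\<F>\<^sub>F\<close> without monomials is a tree in which every inner vertex has at most \<open>N\<close>
  children and the noises sit exactly on the leaves, except for the symbol \<open>\<one>\<close>, whose homogeneity
  is not negative. Such a tree with \<open>p\<close> leaves and \<open>q\<close> edges has \<open>q + 1 - p\<close> inner vertices, so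
  filling each of them up with leaves to \<open>N\<close> children yields a regular tree with
  \<open>r = N (q + 1 - p) - q\<close> additional edges. For \<open>\<rho> > \<rho>\<^sub>c\<close> and small \<open>\<kappa>\<close>, negative homogeneity
  forces \<open>N p > (N - 1) q\<close>, which says precisely that \<open>r < N\<close>; hence \<open>r = 0\<close> if and only if
  \<open>N\<close> divides \<open>q\<close>.
\<close>

section \<open>Symbols without monomials\<close>

inductive noise_tree :: "nat \<Rightarrow> symbol \<Rightarrow> bool" for N :: nat where
  noise: "noise_tree N noise"
| product: "\<sigma>s \<noteq> {#} \<Longrightarrow> size \<sigma>s \<le> N \<Longrightarrow> \<forall>\<sigma>\<in>#\<sigma>s. noise_tree N \<sigma> \<Longrightarrow>
    noise_tree N (image_mset Integ \<sigma>s)"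

lemma noise_tree_integ:
  assumes "noise_tree N \<sigma>" and "1 \<le> N"
  shows "noise_tree N (integ \<sigma>)"
  using noise_tree.product[of "{#\<sigma>#}" N] assms by (simp add: integ_def)

lemma exponent_eq_0_iff: "exponent \<tau> j = 0 \<longleftrightarrow> (\<forall>f\<in>#\<tau>. exponent_factor j f = 0)"
  by (auto simp: exponent_def)

lemma exponent_integ: "exponent (integ \<tau>) = exponent \<tau>"
  by (auto simp: exponent_def integ_def)

lemma exponent_sum_eq_0:
  assumes "finite A" and "exponent (\<Sum>i\<in>A. \<tau> i) = (\<lambda>_. 0)" and "i \<in> A"
  shows "exponent (\<tau> i) = (\<lambda>_. 0)"
proof
  fix j
  have "exponent (\<Sum>i\<in>A. \<tau> i) j = 0"
    by (simp add: assms(2))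
  then show "exponent (\<tau> i) j = 0"
    using assms(1,3) by (auto simp: exponent_eq_0_iff set_mset_sum)
qed

lemma monomial_0: "monomial d (\<lambda>_. 0) = {#}"
  by (simp add: monomial_def)

text \<open>A nonzero \<open>k i\<close> with \<open>i \<le> d\<close> would leave a factor
  \<open>X i\<close> with visible exponent. Since \<open>k\<close> is arbitrary beyond
  \<open>d\<close>, the conclusion concerns the symbol, not \<open>k\<close>.\<close>

lemma monomial_exponent_0:
  assumes "exponent (monomial d k) = (\<lambda>_. 0)"
  shows "monomial d k = {#}"
proof -
  have "k i = 0" if "i \<le> d" for i
  proof (rule ccontr)
    assume "k i \<noteq> 0"
    then have "X i \<in># monomial d k"
      using that by (auto simp: monomial_def set_mset_sum)
    moreover have "exponent (monomial d k) i = 0"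
      by (simp add: assms)
    ultimately show False
      by (auto simp: exponent_eq_0_iff)
  qed
  then show ?thesis
    by (simp add: monomial_def)
qed

text \<open>Applied to products of elements of \<open>U\<close>: unit factors vanish, hence only an
  upper bound on the number of edges at the root.\<close>

lemma sum_integs:
  assumes "finite A" and "\<And>i. i \<in> A \<Longrightarrow> \<tau> i = {#} \<or> (\<exists>\<sigma>. P \<sigma> \<and> \<tau> i = integ \<sigma>)"
  shows "\<exists>\<sigma>s. size \<sigma>s \<le> card A \<and> (\<forall>\<sigma>\<in>#\<sigma>s. P \<sigma>) \<and> (\<Sum>i\<in>A. \<tau> i) = image_mset Integ \<sigma>s"
  using assms
proof (induction rule: finite_induct)
  case empty
  show ?case
    by (rule exI[of _ "{#}"]) simp
next
  case (insert a A)
  then obtain \<sigma>s where \<sigma>s: "size \<sigma>s \<le> card A" "\<forall>\<sigma>\<in>#\<sigma>s. P \<sigma>"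
    "(\<Sum>i\<in>A. \<tau> i) = image_mset Integ \<sigma>s"
    by auto
  from insert.prems[of a] consider "\<tau> a = {#}" | \<sigma> where "P \<sigma>" "\<tau> a = integ \<sigma>"
    by auto
  then show ?case
  proof cases
    case 1
    then show ?thesis
      using \<sigma>s insert.hyps by (intro exI[of _ \<sigma>s]) simp
  next
    case 2
    then show ?thesis
      using \<sigma>s insert.hyps by (intro exI[of _ "add_mset \<sigma> \<sigma>s"]) (simp add: integ_def)
  qed
qed

text \<open>The claim for \<open>U\<close> is stronger: each factor contributes a single edge at the
  root, which is what keeps a product of at most \<open>N\<close> factors within \<open>N\<close>
  children.\<close>

lemma noise_tree_W_U:
  "(\<tau> \<in> W N d m \<longrightarrow> exponent \<tau> = (\<lambda>_. 0) \<longrightarrow> \<tau> \<noteq> {#} \<longrightarrow> noise_tree N \<tau>) \<and>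
   (\<tau> \<in> U N d m \<longrightarrow> exponent \<tau> = (\<lambda>_. 0) \<longrightarrow> \<tau> \<noteq> {#} \<longrightarrow>
     (\<exists>\<sigma>. noise_tree N \<sigma> \<and> \<tau> = integ \<sigma>))"
proof (induction m arbitrary: \<tau>)
  case (Suc m)
  have W: "noise_tree N \<tau>"
    if \<tau>: "\<tau> \<in> W N d (Suc m)" "exponent \<tau> = (\<lambda>_. 0)" "\<tau> \<noteq> {#}" for \<tau>
  proof -
    from \<tau>(1) consider "\<tau> \<in> W N d m" | "\<tau> = noise"
      | n \<upsilon> where "n \<in> {1..N}" "\<tau> = (\<Sum>i=1..n. \<upsilon> i)" "\<forall>i\<in>{1..n}. \<upsilon> i \<in> U N d m"
      by auto
    then show ?thesis
    proof cases
      case 1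
      then show ?thesis
        using Suc \<tau> by blast
    next
      case 2
      then show ?thesis
        by (simp add: noise_tree.noise)
    next
      case 3
      have "\<upsilon> i = {#} \<or> (\<exists>\<sigma>. noise_tree N \<sigma> \<and> \<upsilon> i = integ \<sigma>)" if "i \<in> {1..n}" for i
        using Suc 3(3) that exponent_sum_eq_0[OF _ \<tau>(2)[unfolded 3(2)] that] by blast
      then obtain \<sigma>s where "size \<sigma>s \<le> n"
        "\<forall>\<sigma>\<in>#\<sigma>s. noise_tree N \<sigma>" "\<tau> = image_mset Integ \<sigma>s"
        using sum_integs[of "{1..n}" \<upsilon> "noise_tree N"] 3(2) by auto
      then show ?thesis
        using 3(1) \<tau>(3) noise_tree.product[of \<sigma>s N] by auto
    qed
  qed
  have U: "\<exists>\<sigma>. noise_tree N \<sigma> \<and> \<tau> = integ \<sigma>"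
    if \<tau>: "\<tau> \<in> U N d (Suc m)" "exponent \<tau> = (\<lambda>_. 0)" "\<tau> \<noteq> {#}" for \<tau>
  proof -
    from \<tau>(1) consider k where "\<tau> = monomial d k"
      | \<sigma> where "\<tau> = integ \<sigma>" "\<sigma> \<in> W N d (Suc m)" "\<sigma> \<notin> range (monomial d)"
      unfolding U.simps by blast
    then show ?thesis
    proof cases
      case 1
      then show ?thesis
        using \<tau> monomial_exponent_0 by auto
    next
      case 2
      \<comment> \<open>The unit is the monomial with zero exponents, so the convention on \<I> of
        monomials excludes it.\<close>
      from 2(3) have "\<sigma> \<noteq> {#}"
        by (metis monomial_0 rangeI)
      then show ?thesis
        using 2 W[of \<sigma>] \<tau>(2) by (auto simp: exponent_integ)
    qed
  qed
  show ?case
    using W U by blast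
qed simp

lemma noise_tree_symbols_F:
  assumes "1 \<le> N" and "\<tau> \<in> symbols_F N d" and "exponent \<tau> = (\<lambda>_. 0)" and "\<tau> \<noteq> {#}"
  shows "noise_tree N \<tau>"
  using assms noise_tree_W_U[of \<tau> N d] noise_tree_integ unfolding symbols_F_def by blast

section \<open>Edge removal\<close>

lemma remove_edge_union:
  assumes "remove_edge (Node ts) (Node ts')"
  shows "remove_edge (Node (ts + us)) (Node (ts' + us))"
  using assms by cases (auto intro: remove_edge.intros)

text \<open>With the next lemma, removals inside one subtree and among its siblings can be carried
  out in succession, the rest staying fixed.\<close>

lemma relpowp_remove_edge_union:
  "(remove_edge ^^ n) (Node ts) (Node ts') \<Longrightarrow>
    (remove_edge ^^ n) (Node (ts + us)) (Node (ts' + us))"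
proof (induction n arbitrary: ts')
  case (Suc n)
  from Suc.prems obtain s where s: "(remove_edge ^^ n) (Node ts) s" "remove_edge s (Node ts')"
    by (rule relpowp_Suc_E)
  moreover obtain ss where "s = Node ss"
    by (cases s)
  ultimately show ?case
    using relpowp_Suc_I[OF Suc.IH remove_edge_union] by simp
qed simp

lemma relpowp_remove_edge_below:
  "(remove_edge ^^ n) t t' \<Longrightarrow>
    (remove_edge ^^ n) (Node (add_mset t ts)) (Node (add_mset t' ts))"
proof (induction n arbitrary: t')
  case (Suc n)
  from Suc.prems obtain s where "(remove_edge ^^ n) t s" "remove_edge s t'"
    by (rule relpowp_Suc_E)
  then show ?case
    by (intro relpowp_Suc_I[OF Suc.IH remove_edge.below])
qed simp

lemma relpowp_remove_edge_leaves:
  "(remove_edge ^^ n) (Node (replicate_mset n (Node {#}) + ts)) (Node ts)"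
proof (induction n)
  case (Suc n)
  have "remove_edge (Node (replicate_mset (Suc n) (Node {#}) + ts))
      (Node (replicate_mset n (Node {#}) + ts))"
    by (simp add: remove_edge.here)
  then show ?case
    using Suc.IH by (rule relpowp_Suc_I2)
qed simp

lemma vertices_remove_edge: "remove_edge t t' \<Longrightarrow> vertices t = vertices t' + 1"
  by (induction rule: remove_edge.induct) simp_all

lemma vertices_relpowp_remove_edge: "(remove_edge ^^ n) t t' \<Longrightarrow> vertices t = vertices t' + n"
proof (induction n arbitrary: t')
  case (Suc n)
  from Suc.prems obtain s where "(remove_edge ^^ n) t s" "remove_edge s t'"
    by (rule relpowp_Suc_E)
  then show ?case
    using Suc.IH[of s] vertices_remove_edge[of s t'] by simp
qed simp

section \<open>Completion to a regular tree\<close>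

lemma bare_tree_image_Integ: "bare_tree (image_mset Integ \<sigma>s) = Node (image_mset bare_tree \<sigma>s)"
  by (induction \<sigma>s) (simp_all add: bare_tree_def join_roots_def)

lemma noises_image_Integ: "noises (image_mset Integ \<sigma>s) = (\<Sum>\<sigma>\<in>#\<sigma>s. noises \<sigma>)"
  by (induction \<sigma>s) (simp_all add: noises_def)

lemma integs_image_Integ: "integs (image_mset Integ \<sigma>s) = (\<Sum>\<sigma>\<in>#\<sigma>s. integs \<sigma> + 1)"
  by (induction \<sigma>s) (simp_all add: integs_def)

text \<open>
  The equation is \<open>r = N (q + 1 - p) - q\<close>, rearranged to avoid subtraction: \<open>r\<close> counts the children
  missing at the inner vertices.
\<close>

definition completion :: "nat \<Rightarrow> symbol \<Rightarrow> nat \<Rightarrow> rtree \<Rightarrow> bool" where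
  "completion N \<tau> r T \<longleftrightarrow> regular_tree N T \<and> (remove_edge ^^ r) T (bare_tree \<tau>) \<and>
     integs \<tau> + r + N * noises \<tau> = N * integs \<tau> + N"

text \<open>The equation is the sum of the \<open>completion\<close> equations of the subtrees, each
  increased by one on both sides for the edge to the root. The root may still have fewer than
  \<open>N\<close> children, so \<open>Node Ts\<close> is not claimed regular.\<close>

lemma forest_completion:
  assumes "\<forall>\<sigma>\<in>#\<sigma>s. \<exists>r T. completion N \<sigma> r T"
  shows "\<exists>R Ts. size Ts = size \<sigma>s \<and> (\<forall>t\<in>#Ts. regular_tree N t) \<and>
    (remove_edge ^^ R) (Node Ts) (Node (image_mset bare_tree \<sigma>s)) \<and>
    (\<Sum>\<sigma>\<in>#\<sigma>s. integs \<sigma> + 1) + R + N * (\<Sum>\<sigma>\<in>#\<sigma>s. noises \<sigma>) =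
      N * (\<Sum>\<sigma>\<in>#\<sigma>s. integs \<sigma> + 1) + size \<sigma>s"
  using assms
proof (induction \<sigma>s)
  case empty
  show ?case
    by (rule exI[of _ 0], rule exI[of _ "{#}"]) simp
next
  case (add \<sigma> \<sigma>s)
  from add.prems obtain r T where T: "regular_tree N T" "(remove_edge ^^ r) T (bare_tree \<sigma>)"
    "integs \<sigma> + r + N * noises \<sigma> = N * integs \<sigma> + N"
    by (auto simp: completion_def)
  from add obtain R Ts where Ts: "size Ts = size \<sigma>s" "\<forall>t\<in>#Ts. regular_tree N t"
    "(remove_edge ^^ R) (Node Ts) (Node (image_mset bare_tree \<sigma>s))"
    "(\<Sum>\<sigma>\<in>#\<sigma>s. integs \<sigma> + 1) + R + N * (\<Sum>\<sigma>\<in>#\<sigma>s. noises \<sigma>) =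
      N * (\<Sum>\<sigma>\<in>#\<sigma>s. integs \<sigma> + 1) + size \<sigma>s"
    by auto
  \<comment> \<open>First \<open>T\<close> is cut down beside the untouched \<open>Ts\<close>, then
    \<open>Ts\<close> beside the finished \<open>bare_tree \<sigma>\<close>.\<close>
  have "(remove_edge ^^ (r + R)) (Node (add_mset T Ts)) (Node (image_mset bare_tree (add_mset \<sigma> \<sigma>s)))"
    using relpowp_trans[OF relpowp_remove_edge_below[OF T(2), of Ts]
        relpowp_remove_edge_union[OF Ts(3), of "{#bare_tree \<sigma>#}", simplified]]
    by simp
  moreover have "(\<Sum>\<sigma>\<in>#add_mset \<sigma> \<sigma>s. integs \<sigma> + 1) + (r + R) +
      N * (\<Sum>\<sigma>\<in>#add_mset \<sigma> \<sigma>s. noises \<sigma>) =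
    N * (\<Sum>\<sigma>\<in>#add_mset \<sigma> \<sigma>s. integs \<sigma> + 1) + size (add_mset \<sigma> \<sigma>s)"
    unfolding image_mset_add_mset sum_mset.add_mset size_add_mset distrib_left
    using T(3) Ts(4) by linarith
  moreover have "size (add_mset T Ts) = size (add_mset \<sigma> \<sigma>s)"
    "\<forall>t\<in>#add_mset T Ts. regular_tree N t"
    using T(1) Ts(1,2) by simp_all
  ultimately show ?case
    by blast
qed

lemma noise_tree_completion: "noise_tree N \<tau> \<Longrightarrow> \<exists>r T. completion N \<tau> r T"
proof (induction rule: noise_tree.induct)
  case noise
  have "completion N noise 0 (Node {#})"
    unfolding completion_def bare_tree_noise
    by (simp add: regular_tree.leaf) (simp add: noise_def noises_def integs_def)
  then show ?case
    by blast
next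
  case (product \<sigma>s)
  then obtain R Ts where Ts: "size Ts = size \<sigma>s" "\<forall>t\<in>#Ts. regular_tree N t"
    "(remove_edge ^^ R) (Node Ts) (Node (image_mset bare_tree \<sigma>s))"
    "(\<Sum>\<sigma>\<in>#\<sigma>s. integs \<sigma> + 1) + R + N * (\<Sum>\<sigma>\<in>#\<sigma>s. noises \<sigma>) =
      N * (\<Sum>\<sigma>\<in>#\<sigma>s. integs \<sigma> + 1) + size \<sigma>s"
    using forest_completion[of \<sigma>s N] by blast
  \<comment> \<open>The number of leaves to add at the root; adding it to both sides of the forest
    equation turns \<open>size \<sigma>s\<close> into \<open>N\<close>.\<close>
  define n where "n = N - size \<sigma>s"
  have n: "size \<sigma>s + n = N"
    using product.hyps by (simp add: n_def)
  let ?T = "Node (replicate_mset n (Node {#}) + Ts)"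
  have "regular_tree N ?T"
    using n Ts(1,2) by (intro regular_tree.inner) (auto simp: regular_tree.leaf)
  moreover have "(remove_edge ^^ (n + R)) ?T (bare_tree (image_mset Integ \<sigma>s))"
    unfolding bare_tree_image_Integ
    by (rule relpowp_trans[OF relpowp_remove_edge_leaves Ts(3)])
  ultimately have "completion N (image_mset Integ \<sigma>s) (n + R) ?T"
    unfolding completion_def noises_image_Integ integs_image_Integ using Ts(4) n by linarith
  then show ?case
    by blast
qed

section \<open>Negative homogeneity\<close>

text \<open>With \<open>a\<close> equal to \<open>-2 * alpha0 d \<rho> \<kappa>\<close>, negative
  homogeneity reads \<open>2 * q * \<rho> < p * a\<close>, and the bound on \<kappa> gives
  \<open>(N - 1) * a \<le> 2 * N * \<rho>\<close>. Chaining these and cancelling \<open>a\<close>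
  leaves \<open>(N - 1) * q < N * p\<close>.\<close>

lemma homogeneity_neg_noises:
  assumes "1 < N" and "0 < \<rho>" and "0 < \<kappa>"
    and \<kappa>: "\<kappa> < ((real N + 1) * \<rho> - (real N - 1) * real d) / (2 * (real N - 1))"
    and exponent: "exponent \<tau> = (\<lambda>_. 0)" and neg: "homogeneity d \<rho> \<kappa> \<tau> < 0"
  shows "N * integs \<tau> < N * noises \<tau> + integs \<tau>"
proof -
  have N: "0 < real N - 1"
    using assms(1) by simp
  define a where "a = \<rho> + real d + 2 * \<kappa>"
  have "0 < a"
    using assms by (simp add: a_def)
  have "(real N - 1) * a \<le> 2 * real N * \<rho>"
    using \<kappa> N by (simp add: a_def field_simps)
  then have "real (integs \<tau>) * ((real N - 1) * a) \<le> real (integs \<tau>) * (2 * real N * \<rho>)"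
    by (intro mult_left_mono) simp_all
  also have "\<dots> = real N * (2 * real (integs \<tau>) * \<rho>)"
    by simp
  also have "\<dots> < real N * (real (noises \<tau>) * a)"
  proof (rule mult_strict_left_mono)
    show "2 * real (integs \<tau>) * \<rho> < real (noises \<tau>) * a"
      using neg by (simp add: homogeneity_def exponent scaled_degree_def alpha0_def a_def field_simps)
  qed (use N in simp)
  finally have "(real (integs \<tau>) * (real N - 1)) * a < (real N * real (noises \<tau>)) * a"
    by (simp add: mult.assoc)
  then have "real (integs \<tau>) * (real N - 1) < real N * real (noises \<tau>)"
    using \<open>0 < a\<close> by simp
  then have "real (N * integs \<tau>) < real (N * noises \<tau> + integs \<tau>)"
    by (simp add: algebra_simps)
  then show ?thesis
    by linarith
qed

theorem proposition4p19:
  fixes N d :: nat and \<rho> :: real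
  assumes "N > 2" and "d \<ge> 1" and "0 < \<rho>" and "\<rho> \<le> 2" and "\<rho> > rho_c N d"
  shows "\<exists>\<kappa>\<^sub>0>0. \<forall>\<kappa>. 0 < \<kappa> \<and> \<kappa> < \<kappa>\<^sub>0 \<longrightarrow>
    (\<forall>\<tau> p q. \<tau> \<in> symbols_F N d \<and> of_type \<tau> p q (\<lambda>_. 0) \<and> homogeneity d \<rho> \<kappa> \<tau> < 0 \<longrightarrow>
      (N dvd q \<longrightarrow> regular_tree N (bare_tree \<tau>) \<and> vertices (bare_tree \<tau>) = q + 1) \<and>
      (\<not> N dvd q \<longrightarrow>
        (\<exists>r T. 1 \<le> r \<and> r \<le> N - 1 \<and> regular_tree N T \<and> vertices T = q + r + 1 \<and>
          (remove_edge ^^ r) T (bare_tree \<tau>))))"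
proof -
  \<comment> \<open>The value of \<kappa> at which
    \<open>(N - 1) * (\<rho> + d + 2 * \<kappa>) = 2 * N * \<rho>\<close>; it is positive exactly
    when \<rho> exceeds \<open>rho_c N d\<close>.\<close>
  let ?\<kappa>\<^sub>0 = "((real N + 1) * \<rho> - (real N - 1) * real d) / (2 * (real N - 1))"
  have "0 < ?\<kappa>\<^sub>0"
    using assms by (simp add: rho_c_def field_simps)
  moreover have "(N dvd q \<longrightarrow> regular_tree N (bare_tree \<tau>) \<and> vertices (bare_tree \<tau>) = q + 1) \<and>
      (\<not> N dvd q \<longrightarrow>
        (\<exists>r T. 1 \<le> r \<and> r \<le> N - 1 \<and> regular_tree N T \<and> vertices T = q + r + 1 \<and>
          (remove_edge ^^ r) T (bare_tree \<tau>)))"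
    if \<kappa>: "0 < \<kappa>" "\<kappa> < ?\<kappa>\<^sub>0" and \<tau>: "\<tau> \<in> symbols_F N d" "of_type \<tau> p q (\<lambda>_. 0)"
      "homogeneity d \<rho> \<kappa> \<tau> < 0" for \<kappa> \<tau> p q
  proof -
    from \<tau>(2) have type: "noises \<tau> = p" "integs \<tau> = q" "exponent \<tau> = (\<lambda>_. 0)"
      by (simp_all add: of_type_def)
    have less: "N * q < N * p + q"
      using homogeneity_neg_noises[OF _ assms(3) \<kappa> type(3) \<tau>(3)] assms(1) type by simp
    \<comment> \<open>For the unit, \<open>p = q = 0\<close> would make the strict inequality read
      \<open>0 < 0\<close>.\<close>
    have "\<tau> \<noteq> {#}"
      using less type by (auto simp: noises_def integs_def)
    then have "noise_tree N \<tau>"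
      using noise_tree_symbols_F assms(1) \<tau>(1) type(3) by simp
    then obtain r T where T: "regular_tree N T" "(remove_edge ^^ r) T (bare_tree \<tau>)"
      "q + r + N * p = N * q + N"
      using noise_tree_completion type by (metis completion_def)
    have "r < N"
      using T(3) less by linarith
    \<comment> \<open>Modulo \<open>N\<close> the completion equation says \<open>q + r = 0\<close>,
      so \<open>N\<close> divides \<open>q\<close> iff it divides \<open>r\<close>, which for
      \<open>r < N\<close> means \<open>r = 0\<close>.\<close>
    have "N dvd (q + r) + N * p"
      using T(3) by simp
    then have dvd: "N dvd q + r"
      by (simp add: dvd_add_left_iff)
    then have "N dvd q \<longleftrightarrow> N dvd r"
      by (metis dvd_add_left_iff dvd_add_right_iff)
    also have "\<dots> \<longleftrightarrow> r = 0"
      using \<open>r < N\<close> by (auto dest: nat_dvd_not_less[of r N])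
    finally have "N dvd q \<longleftrightarrow> r = 0" .
    moreover have "vertices T = q + r + 1"
      using vertices_relpowp_remove_edge[OF T(2)] type by (simp add: vertices_bare_tree)
    moreover have "1 \<le> r \<and> r \<le> N - 1" if "r \<noteq> 0"
      using that \<open>r < N\<close> by simp
    \<comment> \<open>With zero removals \<open>T\<close> is the bare tree itself.\<close>
    moreover have "regular_tree N (bare_tree \<tau>)" if "r = 0"
      using T(1,2) that by simp
    moreover have "vertices (bare_tree \<tau>) = q + 1"
      using type by (simp add: vertices_bare_tree)
    ultimately show ?thesis
      using T(1,2) by blast
  qed
  ultimately show ?thesis
    by (intro exI[of _ ?\<kappa>\<^sub>0] conjI[OF \<open>0 < ?\<kappa>\<^sub>0\<close>] allI impI) (elim conjE)
qed

end
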